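(* Let $(V_1, V_2)$ on $\mathcal{H}$ and $(\tilde{V}_1, \tilde{V}_2)$ on $\tilde{\mathcal{H}}$ be irreducible $2$-finite pairs, with $\sigma([V_2^*,V_1])\setminus \{0\} = \{\alpha\}$ and $\sigma([\tilde{V}_2^*,\tilde{V}_1])\setminus \{0\} = \{\tilde{\alpha}\}$. Then $(V_1, V_2)$ and $(\tilde{V}_1, \tilde{V}_2)$ are unitarily equivalent if and only if $\alpha = \tilde{\alpha}$.
   Context: All Hilbert spaces are complex and separable. An isometric pair is a pair $(V_1,V_2)$ of commuting isometries. An isometry $V$ is a shift if $V^{*m}\to0$ strongly. A BCL pair is an isometric pair with $V_1V_2$ a shift. $[V_2^*,V_1] := V_2^*V_1 - V_1V_2^*$. A compact normal pair is a BCL pair with $[V_2^*,V_1]$ compact and normal. $C(V_1,V_2) := I - V_1V_1^* - V_2V_2^* + V_1V_2V_1^*V_2^*$. A $2$-finite pair is a compact normal pair with $\operatorname{rank} C(V_1,V_2)=2$. Irreducible: no closed subspace other than $\{0\}$ and the whole space invariant under $V_1,V_2,V_1^*,V_2^*$. Unitary equivalence of pairs means a single unitary $U$ with $UV_i = \tilde V_i U$, $i=1,2$. *)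

theory Defs
  imports "HOL-Analysis.Analysis"
begin

class complex_inner = real_normed_vector +
  fixes scaleC :: "complex \<Rightarrow> 'a \<Rightarrow> 'a"
    and cinner :: "'a \<Rightarrow> 'a \<Rightarrow> complex"
  assumes scaleC_add_right: "scaleC a (x + y) = scaleC a x + scaleC a y"
    and scaleC_add_left: "scaleC (a + b) x = scaleC a x + scaleC b x"
    and scaleC_scaleC: "scaleC a (scaleC b x) = scaleC (a * b) x"
    and scaleC_one: "scaleC 1 x = x"
    and scaleC_of_real: "scaleC (complex_of_real r) x = scaleR r x"
    and cinner_add_right: "cinner x (y + z) = cinner x y + cinner x z"
    and cinner_scaleC_right: "cinner x (scaleC a y) = a * cinner x y"
    and cinner_commute: "cinner y x = cnj (cinner x y)"
    and cinner_self_real: "Im (cinner x x) = 0"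
    and cinner_self_nonneg: "Re (cinner x x) \<ge> 0"
    and cinner_self_zero: "cinner x x = 0 \<longleftrightarrow> x = 0"
    and norm_eq_sqrt_cinner: "norm x = sqrt (Re (cinner x x))"

class chilbert_space = complex_inner + complete_space

instantiation complex :: complex_inner
begin
definition scaleC_complex :: "complex \<Rightarrow> complex \<Rightarrow> complex" where
  "scaleC_complex a x = a * x"
definition cinner_complex :: "complex \<Rightarrow> complex \<Rightarrow> complex" where
  "cinner_complex x y = cnj x * y"
instance
proof
  fix a b :: complex and x y z :: complex and r :: real
  show "scaleC a (x + y) = scaleC a x + scaleC a y" by (simp add: scaleC_complex_def algebra_simps)
  show "scaleC (a + b) x = scaleC a x + scaleC b x" by (simp add: scaleC_complex_def algebra_simps)
  show "scaleC a (scaleC b x) = scaleC (a * b) x" by (simp add: scaleC_complex_def)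
  show "scaleC 1 x = x" by (simp add: scaleC_complex_def)
  show "scaleC (complex_of_real r) x = scaleR r x" by (simp add: scaleC_complex_def scaleR_conv_of_real)
  show "cinner x (y + z) = cinner x y + cinner x z" by (simp add: cinner_complex_def algebra_simps)
  show "cinner x (scaleC a y) = a * cinner x y" by (simp add: cinner_complex_def scaleC_complex_def)
  show "cinner y x = cnj (cinner x y)" by (simp add: cinner_complex_def)
  show "Im (cinner x x) = 0" by (simp add: cinner_complex_def)
  show "Re (cinner x x) \<ge> 0" by (simp add: cinner_complex_def)
  show "cinner x x = 0 \<longleftrightarrow> x = 0" by (simp add: cinner_complex_def)
  show "norm x = sqrt (Re (cinner x x))" by (simp add: cinner_complex_def cmod_def power2_eq_square)
qed
end

instance complex :: chilbert_space ..

definition separable_space :: "'a::topological_space itself \<Rightarrow> bool" where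
  "separable_space _ \<longleftrightarrow> (\<exists>D::'a set. countable D \<and> closure D = UNIV)"

definition clinear :: "('a::complex_inner \<Rightarrow> 'b::complex_inner) \<Rightarrow> bool" where
  "clinear f \<longleftrightarrow> (\<forall>x y. f (x + y) = f x + f y) \<and> (\<forall>c x. f (scaleC c x) = scaleC c (f x))"

definition bounded_clinear :: "('a::complex_inner \<Rightarrow> 'b::complex_inner) \<Rightarrow> bool" where
  "bounded_clinear f \<longleftrightarrow> clinear f \<and> (\<exists>K. \<forall>x. norm (f x) \<le> K * norm x)"

text \<open>Hilbert space adjoint of a bounded operator (it exists and is unique by Riesz).\<close>
definition adj :: "('a::chilbert_space \<Rightarrow> 'a) \<Rightarrow> ('a \<Rightarrow> 'a)" where
  "adj T = (SOME S. \<forall>x y. cinner (T x) y = cinner x (S y))"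

definition isometry :: "('a::chilbert_space \<Rightarrow> 'a) \<Rightarrow> bool" where
  "isometry V \<longleftrightarrow> bounded_clinear V \<and> (\<forall>x. norm (V x) = norm x)"

definition shift :: "('a::chilbert_space \<Rightarrow> 'a) \<Rightarrow> bool" where
  "shift V \<longleftrightarrow> isometry V \<and> (\<forall>x. (\<lambda>m. (adj V ^^ m) x) \<longlonglongrightarrow> 0)"

definition isometric_pair :: "('a::chilbert_space \<Rightarrow> 'a) \<Rightarrow> ('a \<Rightarrow> 'a) \<Rightarrow> bool" where
  "isometric_pair V1 V2 \<longleftrightarrow> isometry V1 \<and> isometry V2 \<and> V1 \<circ> V2 = V2 \<circ> V1"

definition BCL_pair :: "('a::chilbert_space \<Rightarrow> 'a) \<Rightarrow> ('a \<Rightarrow> 'a) \<Rightarrow> bool" where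
  "BCL_pair V1 V2 \<longleftrightarrow> isometric_pair V1 V2 \<and> shift (V1 \<circ> V2)"

definition cross_comm :: "('a::chilbert_space \<Rightarrow> 'a) \<Rightarrow> ('a \<Rightarrow> 'a) \<Rightarrow> ('a \<Rightarrow> 'a)" where
  "cross_comm V1 V2 = (\<lambda>x. adj V2 (V1 x) - V1 (adj V2 x))"

definition compact_op :: "('a::chilbert_space \<Rightarrow> 'a) \<Rightarrow> bool" where
  "compact_op T \<longleftrightarrow> bounded_clinear T \<and> (\<forall>B. bounded B \<longrightarrow> compact (closure (T ` B)))"

definition normal_op :: "('a::chilbert_space \<Rightarrow> 'a) \<Rightarrow> bool" where
  "normal_op T \<longleftrightarrow> bounded_clinear T \<and> T \<circ> adj T = adj T \<circ> T"

definition compact_normal_pair :: "('a::chilbert_space \<Rightarrow> 'a) \<Rightarrow> ('a \<Rightarrow> 'a) \<Rightarrow> bool" where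
  "compact_normal_pair V1 V2 \<longleftrightarrow> BCL_pair V1 V2 \<and> compact_op (cross_comm V1 V2)
     \<and> normal_op (cross_comm V1 V2)"

definition defect_op :: "('a::chilbert_space \<Rightarrow> 'a) \<Rightarrow> ('a \<Rightarrow> 'a) \<Rightarrow> ('a \<Rightarrow> 'a)" where
  "defect_op V1 V2 = (\<lambda>x. x - V1 (adj V1 x) - V2 (adj V2 x) + V1 (V2 (adj V1 (adj V2 x))))"

definition rank_two :: "('a::chilbert_space \<Rightarrow> 'a) \<Rightarrow> bool" where
  "rank_two T \<longleftrightarrow> (\<exists>u v. (\<forall>a b. scaleC a u + scaleC b v = 0 \<longrightarrow> a = 0 \<and> b = 0)
      \<and> range T = {scaleC a u + scaleC b v | a b. True})"

definition two_finite_pair :: "('a::chilbert_space \<Rightarrow> 'a) \<Rightarrow> ('a \<Rightarrow> 'a) \<Rightarrow> bool" where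
  "two_finite_pair V1 V2 \<longleftrightarrow> compact_normal_pair V1 V2 \<and> rank_two (defect_op V1 V2)"

definition csubspace :: "'a::complex_inner set \<Rightarrow> bool" where
  "csubspace M \<longleftrightarrow> 0 \<in> M \<and> (\<forall>x\<in>M. \<forall>y\<in>M. x + y \<in> M) \<and> (\<forall>c. \<forall>x\<in>M. scaleC c x \<in> M)"

definition irreducible_pair :: "('a::chilbert_space \<Rightarrow> 'a) \<Rightarrow> ('a \<Rightarrow> 'a) \<Rightarrow> bool" where
  "irreducible_pair V1 V2 \<longleftrightarrow> (\<forall>M. csubspace M \<and> closed M \<and> V1 ` M \<subseteq> M \<and> V2 ` M \<subseteq> M
      \<and> adj V1 ` M \<subseteq> M \<and> adj V2 ` M \<subseteq> M \<longrightarrow> M = {0} \<or> M = UNIV)"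

definition spectrum :: "('a::chilbert_space \<Rightarrow> 'a) \<Rightarrow> complex set" where
  "spectrum T = {l. \<not> (\<exists>S. bounded_clinear S \<and> (\<forall>x. S (T x - scaleC l x) = x)
      \<and> (\<forall>x. T (S x) - scaleC l (S x) = x))}"

definition unitary :: "('a::chilbert_space \<Rightarrow> 'b::chilbert_space) \<Rightarrow> bool" where
  "unitary U \<longleftrightarrow> clinear U \<and> bij U \<and> (\<forall>x. norm (U x) = norm x)"

definition unitarily_equivalent_pairs ::
  "('a::chilbert_space \<Rightarrow> 'a) \<Rightarrow> ('a \<Rightarrow> 'a) \<Rightarrow> ('b::chilbert_space \<Rightarrow> 'b) \<Rightarrow> ('b \<Rightarrow> 'b) \<Rightarrow> bool" where
  "unitarily_equivalent_pairs V1 V2 W1 W2 \<longleftrightarrow>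
     (\<exists>U. unitary U \<and> U \<circ> V1 = W1 \<circ> U \<and> U \<circ> V2 = W2 \<circ> U)"

end

theory Submission
  imports Defs
begin

text \<open>Write \<open>N = [V2\<^sup>*, V1]\<close>. Since \<open>N\<close> is compact and normal, \<open>\<alpha> \<noteq> 0\<close> has a unit eigenvector
  \<open>f\<close> with \<open>N f = \<alpha> f\<close> and \<open>N\<^sup>* f = cnj \<alpha> f\<close>; as \<open>V1\<^sup>* N = 0 = V2\<^sup>* N\<^sup>*\<close>, it lies in
  \<open>ker V1\<^sup>* \<inter> ker V2\<^sup>*\<close>. The defect operator maps \<open>f\<close> to \<open>f\<close>, \<open>V1 f\<close> to \<open>-\<alpha> V2 f\<close> and \<open>V2 f\<close> to
  \<open>-cnj \<alpha> V1 f\<close>, so rank two forces \<open>V2 f = cnj \<alpha> V1 f\<close> and \<open>|\<alpha>| = 1\<close>. The closed span of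
  \<open>V1\<^sup>k f\<close> is then reducing, hence everything, and \<open>(V1, V2)\<close> is \<open>(S, cnj \<alpha> S)\<close> for the unilateral
  shift \<open>S\<close>. So \<open>\<alpha>\<close> is a complete invariant.\<close>

section \<open>Complex inner product spaces\<close>

lemma scaleC_zero_right [simp]: "scaleC a (0::'a::complex_inner) = 0"
  using scaleC_add_right[of a 0 "0::'a"] by simp

lemma scaleC_zero_left [simp]: "scaleC 0 (x::'a::complex_inner) = 0"
  using scaleC_add_left[of 0 0 x] by simp

lemma scaleC_minus_right: "scaleC a (- x) = - scaleC a (x::'a::complex_inner)"
  using scaleC_add_right[of a x "- x"] by (simp add: eq_neg_iff_add_eq_0 add.commute)

lemma scaleC_minus_left: "scaleC (- a) x = - scaleC a (x::'a::complex_inner)"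
  using scaleC_add_left[of a "- a" x] by (simp add: eq_neg_iff_add_eq_0 add.commute)

lemma scaleC_diff_right: "scaleC a (x - y) = scaleC a x - scaleC a (y::'a::complex_inner)"
  using scaleC_add_right[of a x "- y"] by (simp add: scaleC_minus_right)

lemma scaleC_diff_left: "scaleC (a - b) x = scaleC a x - scaleC b (x::'a::complex_inner)"
  using scaleC_add_left[of a "- b" x] by (simp add: scaleC_minus_left)

lemma scaleC_sum_right: "scaleC a (sum f A) = (\<Sum>k\<in>A. scaleC a (f k :: 'a::complex_inner))"
  by (induction A rule: infinite_finite_induct) (simp_all add: scaleC_add_right)

lemma cinner_add_left: "cinner (x + y) z = cinner x z + cinner y (z::'a::complex_inner)"
  by (metis cinner_commute cinner_add_right complex_cnj_add)

lemma cinner_scaleC_left: "cinner (scaleC a x) y = cnj a * cinner x (y::'a::complex_inner)"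
  by (metis cinner_commute cinner_scaleC_right complex_cnj_mult)

lemma cinner_scaleR_right: "cinner x (r *\<^sub>R y) = of_real r * cinner x (y::'a::complex_inner)"
  by (simp add: cinner_scaleC_right flip: scaleC_of_real)

lemma cinner_zero_right [simp]: "cinner x (0::'a::complex_inner) = 0"
  using cinner_add_right[of x 0 0] by simp

lemma cinner_zero_left [simp]: "cinner (0::'a::complex_inner) x = 0"
  using cinner_add_left[of 0 0 x] by simp

lemma cinner_minus_right: "cinner x (- y) = - cinner x (y::'a::complex_inner)"
  using cinner_add_right[of x y "- y"] by (simp add: eq_neg_iff_add_eq_0 add.commute)

lemma cinner_minus_left: "cinner (- x) y = - cinner x (y::'a::complex_inner)"
  using cinner_add_left[of x "- x" y] by (simp add: eq_neg_iff_add_eq_0 add.commute)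

lemma cinner_diff_right: "cinner x (y - z) = cinner x y - cinner x (z::'a::complex_inner)"
  using cinner_add_right[of x y "- z"] by (simp add: cinner_minus_right)

lemma cinner_diff_left: "cinner (x - y) z = cinner x z - cinner y (z::'a::complex_inner)"
  using cinner_add_left[of x "- y" z] by (simp add: cinner_minus_left)

lemma cinner_sum_right: "cinner x (sum f A) = (\<Sum>k\<in>A. cinner x (f k :: 'a::complex_inner))"
  by (induction A rule: infinite_finite_induct) (simp_all add: cinner_add_right)

lemma cinner_sum_left: "cinner (sum f A) x = (\<Sum>k\<in>A. cinner (f k) (x :: 'a::complex_inner))"
  by (induction A rule: infinite_finite_induct) (simp_all add: cinner_add_left)

lemma cinner_self_eq_norm: "cinner x x = of_real ((norm (x::'a::complex_inner))\<^sup>2)"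
  by (simp add: complex_eq_iff norm_eq_sqrt_cinner cinner_self_real cinner_self_nonneg)

lemma norm_add_sq:
  "(norm (x + y))\<^sup>2 = (norm x)\<^sup>2 + 2 * Re (cinner x y) + (norm (y::'a::complex_inner))\<^sup>2"
proof -
  have "Re (cinner y x) = Re (cinner x y)"
    using cinner_commute[of x y] by simp
  then show ?thesis
    using cinner_self_eq_norm[of "x + y"] cinner_self_eq_norm[of x] cinner_self_eq_norm[of y]
    by (simp add: complex_eq_iff cinner_add_left cinner_add_right)
qed

lemma norm_scaleC: "norm (scaleC a x) = cmod a * norm (x::'a::complex_inner)"
proof -
  have "complex_of_real ((norm (scaleC a x))\<^sup>2) = (cnj a * a) * cinner x x"
    unfolding cinner_self_eq_norm[symmetric] by (simp add: cinner_scaleC_left cinner_scaleC_right)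
  also have "\<dots> = of_real ((cmod a * norm x)\<^sup>2)"
    using complex_norm_square[of a] by (simp add: cinner_self_eq_norm power_mult_distrib mult.commute)
  finally have "complex_of_real ((norm (scaleC a x))\<^sup>2) = of_real ((cmod a * norm x)\<^sup>2)" .
  then show ?thesis
    by (metis of_real_eq_iff norm_ge_zero mult_nonneg_nonneg power2_eq_imp_eq)
qed

text \<open>Cauchy-Schwarz, derived from the triangle inequality that the class already supplies:
  squaring it bounds the real part of the inner product. Multiplying \<open>y\<close> by the phase
  \<open>t\<close> of modulus 1 makes the inner product equal to its own modulus.\<close>

lemma norm_cinner_le: "cmod (cinner x y) \<le> norm x * norm (y::'a::complex_inner)"
proof (cases "cinner x y = 0")
  case False
  have re: "Re (cinner u v) \<le> norm u * norm v" for u v :: 'a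
  proof -
    have "(norm (u + v))\<^sup>2 \<le> (norm u + norm v)\<^sup>2"
      by (simp add: norm_triangle_ineq power_mono)
    then show ?thesis by (simp add: norm_add_sq power2_sum)
  qed
  define t where "t = cnj (cinner x y) / cmod (cinner x y)"
  have "cinner x (scaleC t y) = cmod (cinner x y)"
    using False by (simp add: t_def cinner_scaleC_right complex_norm_square[symmetric]
        mult.commute power2_eq_square)
  moreover have "cmod t = 1" using False by (simp add: t_def norm_divide)
  ultimately show ?thesis using re[of x "scaleC t y"] by (simp add: norm_scaleC)
qed simp

lemma cinner_ext:
  assumes "\<And>z. cinner x z = cinner y (z::'a::complex_inner)"
  shows "x = y"
proof -
  have "cinner (x - y) (x - y) = 0"
    using assms by (simp add: cinner_diff_left)
  then show ?thesis by (simp add: cinner_self_zero)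
qed

lemma bounded_linear_scaleC: "bounded_linear (scaleC a :: 'a::complex_inner \<Rightarrow> 'a)"
proof (rule bounded_linear_intro[where K = "cmod a"])
  fix r :: real and x :: 'a
  show "scaleC a (r *\<^sub>R x) = r *\<^sub>R scaleC a x"
    by (simp flip: scaleC_of_real add: scaleC_scaleC mult.commute)
qed (simp_all add: scaleC_add_right norm_scaleC)

lemma bounded_linear_cinner_right: "bounded_linear (cinner (x::'a::complex_inner))"
  by (rule bounded_linear_intro[where K = "norm x"])
     (simp_all add: cinner_add_right cinner_scaleC_right scaleR_conv_of_real
       norm_cinner_le[of x, unfolded mult.commute[of "norm x"]] flip: scaleC_of_real)

lemmas tendsto_scaleC = bounded_linear.tendsto[OF bounded_linear_scaleC]
lemmas tendsto_cinner = bounded_linear.tendsto[OF bounded_linear_cinner_right]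

section \<open>Bounded operators and adjoints\<close>

lemma clinear_add: "clinear f \<Longrightarrow> f (x + y) = f x + f y"
  and clinear_scaleC: "clinear f \<Longrightarrow> f (scaleC c x) = scaleC c (f x)"
  by (simp_all add: clinear_def)

lemma clinear_zero: "clinear f \<Longrightarrow> f 0 = 0"
  using clinear_add[of f 0 0] by simp

lemma clinear_diff: "clinear f \<Longrightarrow> f (x - y) = f x - f y"
  using clinear_add[of f "x - y" y] by (simp add: algebra_simps)

lemma clinear_scaleR: "clinear f \<Longrightarrow> f (r *\<^sub>R x) = r *\<^sub>R f x"
  using clinear_scaleC[of f "of_real r" x] by (simp add: scaleC_of_real)

lemma clinear_minus: "clinear f \<Longrightarrow> f (- x) = - f x"
  using clinear_diff[of f 0 x] by (simp add: clinear_zero)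

lemma clinear_sum: "clinear f \<Longrightarrow> f (sum g A) = (\<Sum>k\<in>A. f (g k))"
  by (induction A rule: infinite_finite_induct) (simp_all add: clinear_zero clinear_add)

lemma bounded_clinear_imp_bounded_linear:
  assumes "bounded_clinear f" shows "bounded_linear f"
proof -
  have lin: "clinear f" using assms by (simp add: bounded_clinear_def)
  obtain K where "\<And>x. norm (f x) \<le> K * norm x" using assms by (auto simp: bounded_clinear_def)
  then show ?thesis
    by (intro bounded_linear_intro[where K = K])
       (simp_all add: clinear_add[OF lin] clinear_scaleR[OF lin] mult.commute)
qed

lemma bounded_clinearI:
  assumes "\<And>x y. f (x + y) = f x + f y" and "\<And>c x. f (scaleC c x) = scaleC c (f x)"
    and "\<And>x. norm (f x) \<le> K * norm x"
  shows "bounded_clinear f"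
  using assms unfolding bounded_clinear_def clinear_def by blast

text \<open>A Lax--Milgram lemma: minimise \<open>\<parallel>A x\<parallel>\<^sup>2 - 2 Re \<phi>(x)\<close>. With \<open>A = id\<close> this is
  Riesz representation; in general it solves \<open>A\<^sup>* A x = y\<close>.\<close>

lemma lax_milgram:
  fixes A :: "'a::chilbert_space \<Rightarrow> 'a" and \<phi> :: "'a \<Rightarrow> complex"
  assumes A: "bounded_clinear A" and c: "c > 0" "\<And>x. c * norm x \<le> norm (A x)"
    and \<phi>: "bounded_clinear \<phi>"
  obtains x where "\<And>y. cinner (A x) (A y) = \<phi> y"
proof -
  have linA: "clinear A" and lin\<phi>: "clinear \<phi>"
    using A \<phi> by (auto simp: bounded_clinear_def)
  obtain B where B: "\<And>x. norm (\<phi> x) \<le> B * norm x"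
    using \<phi> by (auto simp: bounded_clinear_def)
  define J where "J x = (norm (A x))\<^sup>2 - 2 * Re (\<phi> x)" for x
  have J_ge: "- (B\<^sup>2 / c\<^sup>2) \<le> J x" for x
  proof -
    have "(c * norm x)\<^sup>2 \<le> (norm (A x))\<^sup>2"
      using c by (intro power_mono) auto
    moreover have "Re (\<phi> x) \<le> B * norm x"
      using complex_Re_le_cmod[of "\<phi> x"] B[of x] by linarith
    \<comment> \<open>Completing the square turns the coercive term minus the linear term into a
      lower bound independent of \<open>x\<close>.\<close>
    moreover have "0 \<le> (c * norm x - B / c)\<^sup>2" by simp
    moreover have "(c * norm x - B / c)\<^sup>2 = (c * norm x)\<^sup>2 - 2 * (B * norm x) + B\<^sup>2 / c\<^sup>2"
      using c(1) by (simp add: power2_diff power_divide)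
    ultimately show ?thesis
      unfolding J_def by linarith
  qed
  define m where "m = Inf (range J)"
  have m_le: "m \<le> J x" for x
    unfolding m_def by (rule cInf_lower) (use J_ge in \<open>auto simp: bdd_below_def\<close>)
  have "\<exists>x. J x < m + e" if "e > 0" for e
    using cInf_lessD[of "range J" "m + e"] that by (auto simp: m_def)
  then have "\<forall>n. \<exists>x. J x < m + 1 / real (Suc n)" by simp
  then obtain X where X: "\<And>n. J (X n) < m + 1 / real (Suc n)" by metis
  \<comment> \<open>Parallelogram law for \<open>A x\<close> and \<open>A y\<close>, combined with
    \<open>m \<le> J\<close> at the midpoint: two near-minimisers must be close to each
    other.\<close>
  have par: "c\<^sup>2 * (norm (x - y))\<^sup>2 \<le> 2 * (J x - m) + 2 * (J y - m)" for x y
  proof -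
    have "(c * norm (x - y))\<^sup>2 \<le> (norm (A (x - y)))\<^sup>2"
      using c by (intro power_mono) auto
    moreover have "(norm (A (x - y)))\<^sup>2 = 2 * (norm (A x))\<^sup>2 + 2 * (norm (A y))\<^sup>2 - (norm (A (x + y)))\<^sup>2"
      using norm_add_sq[of "A x" "A y"] norm_add_sq[of "A x" "- A y"]
      by (simp add: clinear_add[OF linA] clinear_diff[OF linA] cinner_minus_right)
    moreover have "4 * J ((1/2) *\<^sub>R (x + y)) = (norm (A (x + y)))\<^sup>2 - 4 * Re (\<phi> x) - 4 * Re (\<phi> y)"
      by (simp add: J_def clinear_scaleR[OF linA] clinear_scaleR[OF lin\<phi>] clinear_add[OF lin\<phi>]
          power_divide add_divide_distrib del: scaleR_add_right)
    ultimately show ?thesis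
      using m_le[of "(1/2) *\<^sub>R (x + y)"] by (simp add: J_def power_mult_distrib)
  qed
  have "Cauchy X"
  proof (rule metric_CauchyI)
    fix e :: real assume "e > 0"
    define q where "q = c\<^sup>2 * e\<^sup>2 / 4"
    have "q > 0" using c(1) \<open>e > 0\<close> by (simp add: q_def)
    then obtain M where M: "1 / real (Suc M) < q"
      using reals_Archimedean[of q] by (auto simp: inverse_eq_divide)
    have "dist (X i) (X j) < e" if "i \<ge> M" "j \<ge> M" for i j
    proof -
      have b: "J (X k) - m < q" if "k \<ge> M" for k
      proof -
        have "1 / real (Suc k) \<le> 1 / real (Suc M)" using that by (simp add: frac_le)
        then show ?thesis using X[of k] M by linarith
      qed
      have "c\<^sup>2 * (norm (X i - X j))\<^sup>2 < 4 * q"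
      proof (rule le_less_trans[OF par])
        show "2 * (J (X i) - m) + 2 * (J (X j) - m) < 4 * q"
          using b[OF that(1)] b[OF that(2)] by (simp add: algebra_simps)
      qed
      then have "(norm (X i - X j))\<^sup>2 < e\<^sup>2" using c(1) by (simp add: q_def)
      then show ?thesis using \<open>e > 0\<close> by (simp add: dist_norm power2_less_imp_less)
    qed
    then show "\<exists>M. \<forall>m\<ge>M. \<forall>n\<ge>M. dist (X m) (X n) < e" by blast
  qed
  then obtain x where x: "X \<longlonglongrightarrow> x" using Cauchy_convergent convergentD by blast
  have "(\<lambda>n. J (X n)) \<longlonglongrightarrow> J x"
    unfolding J_def
    by (intro tendsto_intros bounded_linear.tendsto[OF bounded_clinear_imp_bounded_linear[OF A] x]
        bounded_linear.tendsto[OF bounded_clinear_imp_bounded_linear[OF \<phi>] x])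
  moreover have "(\<lambda>n. m + 1 / real (Suc n)) \<longlonglongrightarrow> m + 0"
    by (intro tendsto_intros LIMSEQ_Suc[OF lim_1_over_n])
  ultimately have "J x \<le> m + 0"
    by (rule LIMSEQ_le) (use X less_imp_le in blast)
  have re: "Re (cinner (A x) (A y)) = Re (\<phi> y)" for y
  proof (rule ccontr)
    define d where "d = Re (cinner (A x) (A y)) - Re (\<phi> y)"
    assume "\<not> ?thesis"
    then have d: "d \<noteq> 0" by (simp add: d_def)
    \<comment> \<open>First variation at the minimiser: \<open>t = - d / K\<close> minimises
      \<open>2 * t * d + t^2 * K\<close>, with value \<open>- d^2 / K\<close>. Adding 1 keeps
      \<open>K\<close> positive even when \<open>A y = 0\<close>.\<close>
    define K where "K = (norm (A y))\<^sup>2 + 1"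
    have K: "K > 0" by (simp add: K_def add_nonneg_pos)
    define t where "t = - d / K"
    have "J x \<le> J (x + t *\<^sub>R y)" using \<open>J x \<le> m + 0\<close> m_le[of "x + t *\<^sub>R y"] by linarith
    also have "J (x + t *\<^sub>R y) = J x + 2 * t * d + t\<^sup>2 * (norm (A y))\<^sup>2"
      unfolding J_def
      using norm_add_sq[of "A x" "t *\<^sub>R A y"]
      by (simp add: clinear_add[OF linA] clinear_add[OF lin\<phi>] clinear_scaleR[OF linA]
          clinear_scaleR[OF lin\<phi>] cinner_scaleR_right d_def power_mult_distrib
          algebra_simps)
    finally have "0 \<le> 2 * t * d + t\<^sup>2 * (norm (A y))\<^sup>2" by simp
    also have "\<dots> \<le> 2 * t * d + t\<^sup>2 * K"
      by (simp add: K_def mult_left_mono)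
    also have "\<dots> = - (d\<^sup>2 / K)"
      using K by (simp add: t_def field_simps power2_eq_square)
    also have "\<dots> < 0" using d K by simp
    finally show False by simp
  qed
  \<comment> \<open>Replacing \<open>y\<close> by \<open>\<i>\<close> times \<open>y\<close> turns
    the identity of real parts into that of imaginary parts.\<close>
  have "cinner (A x) (A y) = \<phi> y" for y
    using re[of y] re[of "scaleC \<i> y"]
    by (simp add: complex_eq_iff clinear_scaleC[OF linA] clinear_scaleC[OF lin\<phi>]
        cinner_scaleC_right scaleC_complex_def)
  then show ?thesis by (rule that)
qed

text \<open>Since \<open>adj\<close> is a choice, its identity rests on existence. Riesz
  representation, that is \<open>lax_milgram\<close> with the identity and constant 1, represents
  the functional sending \<open>x\<close> to \<open>cinner y (T x)\<close>.\<close>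

lemma adj_cinner:
  fixes T :: "'a::chilbert_space \<Rightarrow> 'a"
  assumes T: "bounded_clinear T"
  shows "cinner (T x) y = cinner x (adj T y)"
proof -
  have lin: "clinear T" using T by (simp add: bounded_clinear_def)
  obtain K where K: "\<And>x. norm (T x) \<le> K * norm x"
    using T by (auto simp: bounded_clinear_def)
  have "\<exists>s. \<forall>x. cinner (T x) y = cinner x s" for y
  proof -
    have "bounded_clinear (\<lambda>x. cinner y (T x))"
    proof (rule bounded_clinearI[where K = "norm y * K"])
      fix x
      show "norm (cinner y (T x)) \<le> norm y * K * norm x"
        using norm_cinner_le[of y "T x"] mult_left_mono[OF K[of x], of "norm y"]
        by (simp add: mult.assoc)
    qed (simp_all add: clinear_add[OF lin] clinear_scaleC[OF lin] cinner_add_right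
        cinner_scaleC_right scaleC_complex_def)
    moreover have "bounded_clinear (\<lambda>x::'a. x)"
      by (rule bounded_clinearI[where K = 1]) simp_all
    ultimately obtain s where "\<And>x. cinner s x = cinner y (T x)"
      using lax_milgram[of "\<lambda>x. x" 1] by (metis mult_1 order_refl zero_less_one)
    then show ?thesis by (metis cinner_commute)
  qed
  then have "\<exists>S. \<forall>x y. cinner (T x) y = cinner x (S y)" by metis
  then show ?thesis unfolding adj_def by (rule someI2_ex) blast
qed

lemma adj_cinner': "bounded_clinear T \<Longrightarrow> cinner (adj T x) y = cinner x (T y)"
  by (metis adj_cinner cinner_commute)

lemma adj_eqI:
  assumes "bounded_clinear T" and "\<And>x y. cinner (T x) y = cinner x (S y)"
  shows "adj T = S"
proof
  fix y show "adj T y = S y"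
    by (rule cinner_ext) (metis assms adj_cinner cinner_commute)
qed

lemma clinear_adj: "bounded_clinear T \<Longrightarrow> clinear (adj T)"
  unfolding clinear_def
  by (intro conjI allI; rule cinner_ext) (simp_all add: adj_cinner' cinner_add_left cinner_scaleC_left)


section \<open>Eigenvectors of compact normal operators\<close>

text \<open>Normality equates the norms of \<open>T x\<close> and \<open>adj T x\<close>, and the
  cross terms of the two expansions coincide. With the right side zero, an eigenvector of
  \<open>T\<close> is one of \<open>adj T\<close> for the conjugate eigenvalue.\<close>

lemma norm_adj:
  assumes T: "bounded_clinear T" and com: "T \<circ> adj T = adj T \<circ> T"
  shows "norm (adj T x - scaleC (cnj l) x) = norm (T x - scaleC l x)"
proof -
  have lin: "clinear T" using T by (simp add: bounded_clinear_def)
  have "cinner (adj T x) (adj T x) = cinner (T x) (T x)"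
    using com by (metis T adj_cinner adj_cinner' comp_apply)
  then have "cinner (adj T x - scaleC (cnj l) x) (adj T x - scaleC (cnj l) x)
      = cinner (T x - scaleC l x) (T x - scaleC l x)"
    by (simp add: cinner_diff_left cinner_diff_right cinner_scaleC_left cinner_scaleC_right
        adj_cinner'[OF T] adj_cinner[OF T, symmetric] clinear_diff[OF lin] clinear_scaleC[OF lin]
        algebra_simps)
  then show ?thesis
    by (metis cinner_self_eq_norm norm_ge_zero of_real_eq_iff power2_eq_imp_eq)
qed

text \<open>Dichotomy on whether \<open>A = T - l\<close> is bounded below. If it is, normality
  makes \<open>A\<close> invertible, contradicting \<open>l\<close> in the spectrum. If not, unit
  approximate eigenvectors exist and compactness yields a limit.\<close>

lemma compact_normal_eigenvector:
  fixes T :: "'a::chilbert_space \<Rightarrow> 'a"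
  assumes comp: "compact_op T" and norm: "normal_op T" and l: "l \<in> spectrum T" "l \<noteq> 0"
  obtains f where "norm f = 1" "T f = scaleC l f" "adj T f = scaleC (cnj l) f"
proof -
  have T: "bounded_clinear T" and com: "T \<circ> adj T = adj T \<circ> T"
    using norm by (auto simp: normal_op_def)
  then have lin: "clinear T" by (simp add: bounded_clinear_def)
  have blT: "bounded_linear T" by (rule bounded_clinear_imp_bounded_linear[OF T])
  define A where "A x = T x - scaleC l x" for x
  have linA: "clinear A"
    by (auto simp: A_def clinear_def clinear_add[OF lin] clinear_scaleC[OF lin] scaleC_add_right
        scaleC_diff_right scaleC_scaleC mult.commute)
  have "\<exists>f. f \<noteq> 0 \<and> A f = 0"
  proof (cases "\<exists>c>0. \<forall>x. c * norm x \<le> norm (A x)")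
    case True
    then obtain c where c: "c > 0" "\<And>x. c * norm x \<le> norm (A x)" by blast
    obtain K where K: "\<And>x. norm (T x) \<le> K * norm x" using T by (auto simp: bounded_clinear_def)
    have bA: "bounded_clinear A"
    proof (rule bounded_clinearI[where K = "K + cmod l"])
      show "norm (A x) \<le> (K + cmod l) * norm x" for x
        using norm_triangle_ineq4[of "T x" "scaleC l x"] K[of x]
        by (simp add: A_def norm_scaleC algebra_simps)
    qed (simp_all add: clinear_add[OF linA] clinear_scaleC[OF linA])
    define B where "B x = adj T x - scaleC (cnj l) x" for x
    have AB: "A (B x) = B (A x)" for x
      using com unfolding A_def B_def comp_def
      by (simp add: fun_eq_iff clinear_diff[OF lin] clinear_diff[OF clinear_adj[OF T]]
          clinear_scaleC[OF lin] clinear_scaleC[OF clinear_adj[OF T]] scaleC_diff_right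
          scaleC_scaleC mult.commute)
    \<comment> \<open>\<open>B\<close> is the adjoint of \<open>A\<close>. Lax-Milgram solves
      \<open>B (A x) = y\<close>, and since \<open>A\<close> and \<open>B\<close> commute,
      \<open>B x\<close> is a preimage of \<open>y\<close> under \<open>A\<close>.\<close>
    have surj: "\<exists>x. A x = y" for y
    proof -
      have "bounded_clinear (cinner y)"
        by (rule bounded_clinearI[where K = "norm y"])
          (simp_all add: cinner_add_right cinner_scaleC_right scaleC_complex_def norm_cinner_le)
      from lax_milgram[OF bA c this] obtain x where x: "\<And>z. cinner (A x) (A z) = cinner y z"
        by blast
      have "cinner (B (A x)) z = cinner y z" for z
        using x[of z] unfolding B_def A_def[of z]
        by (simp add: cinner_diff_left cinner_diff_right cinner_scaleC_left cinner_scaleC_right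
            adj_cinner'[OF T])
      then show ?thesis using AB by (metis cinner_ext)
    qed
    define S where "S y = (SOME x. A x = y)" for y
    have AS: "A (S y) = y" for y unfolding S_def by (rule someI_ex[OF surj])
    have inj: "x = y" if "A x = A y" for x y
    proof -
      have "c * norm (x - y) \<le> 0" using c(2)[of "x - y"] that by (simp add: clinear_diff[OF linA])
      then show ?thesis using c(1) by (simp add: mult_le_0_iff)
    qed
    have "bounded_clinear S"
    proof (rule bounded_clinearI[where K = "1 / c"])
      show "norm (S y) \<le> 1 / c * norm y" for y
        using c(2)[of "S y"] c(1) by (simp add: AS field_simps)
    qed (rule inj, simp add: AS clinear_add[OF linA] clinear_scaleC[OF linA])+
    moreover have "S (A x) = x" for x by (rule inj) (simp add: AS)
    ultimately have "l \<notin> spectrum T"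
      using AS by (auto simp: spectrum_def A_def)
    then show ?thesis using l by simp
  next
    case False
    have "\<exists>x. norm x = 1 \<and> norm (A x) < 1 / real (Suc n)" for n
    proof -
      have "\<not> (\<forall>x. 1 / real (Suc n) * norm x \<le> norm (A x))"
        using False by (metis divide_pos_pos of_nat_0_less_iff zero_less_Suc zero_less_one)
      then obtain x where x: "norm (A x) < 1 / real (Suc n) * norm x" by (auto simp: not_le)
      then have "x \<noteq> 0" by (auto simp: clinear_zero[OF linA])
      then have "norm (A ((1 / norm x) *\<^sub>R x)) < 1 / real (Suc n)"
        using x by (simp add: clinear_scaleR[OF linA] field_simps)
      moreover have "norm ((1 / norm x) *\<^sub>R x) = 1" using \<open>x \<noteq> 0\<close> by simp
      ultimately show ?thesis by blast
    qed
    then obtain X where X: "\<And>n. norm (X n) = 1" "\<And>n. norm (A (X n)) < 1 / real (Suc n)" by metis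
    have "compact (closure (T ` cball 0 1))"
      using comp by (auto simp: compact_op_def)
    moreover have "\<forall>n. T (X n) \<in> closure (T ` cball 0 1)"
      using X(1) by (intro allI subsetD[OF closure_subset] imageI) simp
    ultimately obtain y r where r: "strict_mono r" "((\<lambda>n. T (X n)) \<circ> r) \<longlonglongrightarrow> y"
      unfolding compact_def by (elim allE[of _ "\<lambda>n. T (X n)"]) blast
    note r = this(1) this(2)[unfolded comp_def]
    have "(\<lambda>n. A (X n)) \<longlonglongrightarrow> 0"
    proof (rule Lim_null_comparison)
      show "\<forall>\<^sub>F n in sequentially. norm (A (X n)) \<le> 1 / real (Suc n)"
        using X(2) less_imp_le by (intro always_eventually) blast
    qed (rule LIMSEQ_Suc[OF lim_1_over_n])
    from LIMSEQ_subseq_LIMSEQ[OF this r(1)] have "(\<lambda>n. A (X (r n))) \<longlonglongrightarrow> 0" by (simp add: comp_def)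
    \<comment> \<open>As \<open>A (X (r n))\<close> tends to 0, the vectors
      \<open>scaleC l (X (r n))\<close> share the limit \<open>y\<close> of
      \<open>T (X (r n))\<close>. Applying \<open>T\<close> gives \<open>T y = scaleC l y\<close>,
      and \<open>norm y = cmod l\<close> is nonzero.\<close>
    from tendsto_diff[OF r(2) this] have lim: "(\<lambda>n. scaleC l (X (r n))) \<longlonglongrightarrow> y"
      by (simp add: A_def)
    have "(\<lambda>n. T (scaleC l (X (r n)))) \<longlonglongrightarrow> T y"
      by (rule bounded_linear.tendsto[OF blT lim])
    moreover have "(\<lambda>n. T (scaleC l (X (r n)))) \<longlonglongrightarrow> scaleC l y"
      using tendsto_scaleC[OF r(2)] by (simp add: clinear_scaleC[OF lin])
    ultimately have "A y = 0" using LIMSEQ_unique by (auto simp: A_def)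
    moreover have "norm y = cmod l"
      using tendsto_norm[OF lim] X(1) by (simp add: norm_scaleC LIMSEQ_const_iff)
    ultimately show ?thesis using l(2) by (intro exI[of _ y]) auto
  qed
  then obtain g where g: "g \<noteq> 0" "A g = 0" by blast
  define f where "f = (1 / norm g) *\<^sub>R g"
  have "norm f = 1" using g(1) by (simp add: f_def)
  moreover have "A f = 0" using g(2) by (simp add: f_def clinear_scaleR[OF linA])
  ultimately show ?thesis
    using that norm_adj[OF T com, of f l] by (auto simp: A_def)
qed

section \<open>Isometric pairs\<close>

text \<open>Polarisation: preserved norms give preserved real parts, and the argument
  \<open>\<i>\<close> times \<open>y\<close> gives the imaginary parts.\<close>

lemma isometry_adj_self:
  assumes "isometry V" shows "adj V (V x) = x"
proof (rule cinner_ext)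
  have V: "bounded_clinear V" and n: "\<And>x. norm (V x) = norm x"
    using assms by (auto simp: isometry_def)
  then have lin: "clinear V" by (simp add: bounded_clinear_def)
  have re: "Re (cinner (V x) (V y)) = Re (cinner x y)" for x y
    using norm_add_sq[of x y] norm_add_sq[of "V x" "V y"] n[of "x + y"]
    by (simp add: clinear_add[OF lin] n)
  have "cinner (V x) (V y) = cinner x y" for y
    using re[of x y] re[of x "scaleC \<i> y"]
    by (simp add: complex_eq_iff clinear_scaleC[OF lin] cinner_scaleC_right)
  then show "cinner (adj V (V x)) y = cinner x y" for y
    by (simp add: adj_cinner'[OF V])
qed

lemma isometry_cinner: "isometry V \<Longrightarrow> cinner (V x) (V y) = cinner x y"
  by (subst adj_cinner) (simp_all add: isometry_adj_self isometry_def)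

lemma isometry_norm: "isometry V \<Longrightarrow> norm (V x) = norm x"
  by (simp add: isometry_def)

lemma isometry_bounded_clinear: "isometry V \<Longrightarrow> bounded_clinear V"
  by (simp add: isometry_def)

lemma isometry_clinear: "isometry V \<Longrightarrow> clinear V"
  by (simp add: isometry_def bounded_clinear_def)

lemma isometry_bounded_linear: "isometry V \<Longrightarrow> bounded_linear V"
  by (simp add: isometry_def bounded_clinear_imp_bounded_linear)

lemma isometry_clinear_adj: "isometry V \<Longrightarrow> clinear (adj V)"
  by (simp add: isometry_def clinear_adj)

lemma isometry_bounded_linear_adj:
  assumes V: "isometry V" shows "bounded_linear (adj V)"
proof (rule bounded_clinear_imp_bounded_linear, rule bounded_clinearI[where K = 1])
  fix x
  have "cinner (V (adj V x)) x = cinner (adj V x) (adj V x)"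
    by (rule adj_cinner[OF isometry_bounded_clinear[OF V]])
  then have "(norm (adj V x))\<^sup>2 = cmod (cinner (V (adj V x)) x)"
    by (simp add: cinner_self_eq_norm norm_power)
  also have "\<dots> \<le> norm (adj V x) * norm x"
    using norm_cinner_le[of "V (adj V x)" x] by (simp add: isometry_norm V)
  finally show "norm (adj V x) \<le> 1 * norm x"
    by (cases "adj V x = 0") (simp_all add: power2_eq_square)
qed (simp_all add: clinear_add clinear_scaleC isometry_clinear_adj V)

lemma adj_commute:
  assumes "isometric_pair V1 V2" shows "adj V1 (adj V2 x) = adj V2 (adj V1 x)"
proof -
  have V: "bounded_clinear V1" "bounded_clinear V2" and com: "V1 \<circ> V2 = V2 \<circ> V1"
    using assms by (auto simp: isometric_pair_def isometry_def)
  show ?thesis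
    by (rule cinner_ext) (use com in \<open>simp add: adj_cinner'[OF V(1)] adj_cinner'[OF V(2)] fun_eq_iff\<close>)
qed

text \<open>Taking the adjoint swaps the two isometries, so each fact about the cross commutator
  carries over to its adjoint by symmetry.\<close>

lemma adj_cross_comm:
  assumes p: "isometric_pair V1 V2" and b: "bounded_clinear (cross_comm V1 V2)"
  shows "adj (cross_comm V1 V2) = cross_comm V2 V1"
proof (rule adj_eqI[OF b])
  have V: "bounded_clinear V1" "bounded_clinear V2"
    using p by (auto simp: isometric_pair_def isometry_def)
  show "cinner (cross_comm V1 V2 x) y = cinner x (cross_comm V2 V1 y)" for x y
    unfolding cross_comm_def
    by (simp add: cinner_diff_left cinner_diff_right adj_cinner[OF V(1)] adj_cinner[OF V(2)]
        adj_cinner'[OF V(1)] adj_cinner'[OF V(2)])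
qed

text \<open>The adjoints commute and \<open>adj V1\<close> is a left inverse of \<open>V1\<close>,
  so both terms become \<open>adj V2 x\<close> and cancel.\<close>

lemma adj_cross_comm_zero:
  assumes p: "isometric_pair V1 V2"
  shows "adj V1 (cross_comm V1 V2 x) = 0"
proof -
  have V: "isometry V1" "isometry V2" using p by (auto simp: isometric_pair_def)
  show ?thesis
    by (simp add: cross_comm_def clinear_diff[OF isometry_clinear_adj[OF V(1)]] adj_commute[OF p]
      isometry_adj_self[OF V(1)])
qed

lemma cross_eigenvector_in_wandering:
  assumes p: "isometric_pair V1 V2" and b: "bounded_clinear (cross_comm V1 V2)"
    and l: "l \<noteq> 0" and f: "cross_comm V1 V2 f = scaleC l f"
      "adj (cross_comm V1 V2) f = scaleC (cnj l) f"
  shows "adj V1 f = 0" "adj V2 f = 0"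
proof -
  have V: "isometry V1" "isometry V2" and p': "isometric_pair V2 V1"
    using p by (auto simp: isometric_pair_def)
  have "scaleC l (adj V1 f) = 0"
    using adj_cross_comm_zero[OF p, of f] by (simp add: f clinear_scaleC isometry_clinear_adj V)
  then show "adj V1 f = 0" using l by (metis norm_eq_zero norm_scaleC mult_eq_0_iff)
  have "scaleC (cnj l) (adj V2 f) = 0"
    using adj_cross_comm_zero[OF p', of f] f(2)
    by (simp add: adj_cross_comm[OF p b] clinear_scaleC isometry_clinear_adj V)
  then show "adj V2 f = 0" using l
    by (metis complex_cnj_zero_iff norm_eq_zero norm_scaleC mult_eq_0_iff)
qed

text \<open>Three vectors in a plane satisfy a linear relation. Pairing it with \<open>x\<close>,
  orthogonal to \<open>y\<close> and \<open>z\<close>, forces the coefficient of \<open>x\<close> to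
  vanish; that coefficient is the determinant of the coordinates of \<open>y\<close> and
  \<open>z\<close>.\<close>

lemma rank_two_orthogonal_dependent:
  fixes T :: "'a::chilbert_space \<Rightarrow> 'a"
  assumes r: "rank_two T" and x: "x \<in> range T" "y \<in> range T" "z \<in> range T"
    and orth: "cinner x y = 0" "cinner x z = 0" and nz: "x \<noteq> 0" "y \<noteq> 0"
  obtains t where "z = scaleC t y"
proof -
  obtain u v where "range T = {scaleC a u + scaleC b v | a b. True}"
    using r by (auto simp: rank_two_def)
  with x obtain a0 b0 a1 b1 a2 b2 where eq: "x = scaleC a0 u + scaleC b0 v"
      "y = scaleC a1 u + scaleC b1 v" "z = scaleC a2 u + scaleC b2 v"
    by auto
  \<comment> \<open>The coefficients below are the 2 by 2 cofactors of the coordinates; both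
    resulting sums are determinants with a repeated row.\<close>
  define d where "d = a1 * b2 - a2 * b1"
  have "scaleC d x + scaleC (a2 * b0 - a0 * b2) y + scaleC (a0 * b1 - a1 * b0) z
      = scaleC (d * a0 + (a2 * b0 - a0 * b2) * a1 + (a0 * b1 - a1 * b0) * a2) u
      + scaleC (d * b0 + (a2 * b0 - a0 * b2) * b1 + (a0 * b1 - a1 * b0) * b2) v"
    unfolding eq by (simp add: scaleC_add_right scaleC_add_left scaleC_scaleC)
  also have "d * a0 + (a2 * b0 - a0 * b2) * a1 + (a0 * b1 - a1 * b0) * a2 = 0"
    by (simp add: d_def algebra_simps)
  also have "d * b0 + (a2 * b0 - a0 * b2) * b1 + (a0 * b1 - a1 * b0) * b2 = 0"
    by (simp add: d_def algebra_simps)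
  finally have "cinner x (scaleC d x + scaleC (a2 * b0 - a0 * b2) y
      + scaleC (a0 * b1 - a1 * b0) z) = 0" by simp
  then have "d * cinner x x = 0"
    by (simp only: cinner_add_right cinner_scaleC_right orth) simp
  then have d: "a1 * b2 = a2 * b1" using nz(1) by (simp add: cinner_self_zero d_def)
  show ?thesis
  proof (cases "b1 = 0")
    case True
    then have "a1 \<noteq> 0" "b2 = 0" using nz(2) d eq(2) by auto
    then have "z = scaleC (a2 / a1) y" using True by (simp add: eq scaleC_scaleC)
    then show ?thesis by (rule that)
  next
    case False
    then have "a2 = b2 / b1 * a1" using d by (simp add: field_simps)
    then have "z = scaleC (b2 / b1) y"
      using False by (simp add: eq scaleC_add_right scaleC_scaleC)
    then show ?thesis by (rule that)
  qed
qed


section \<open>The model\<close>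

text \<open>\<open>(V1, V2) = (S, \<gamma> S)\<close> where \<open>S\<close> is the unilateral shift on the orthonormal basis
  \<open>V1\<^sup>k f\<close>.\<close>

definition rotated_shift_pair ::
  "('a::chilbert_space \<Rightarrow> 'a) \<Rightarrow> ('a \<Rightarrow> 'a) \<Rightarrow> complex \<Rightarrow> 'a \<Rightarrow> bool" where
  "rotated_shift_pair V1 V2 \<gamma> f \<longleftrightarrow> isometry V1 \<and> norm f = 1 \<and> adj V1 f = 0
     \<and> (\<forall>x. V2 x = scaleC \<gamma> (V1 x))
     \<and> (\<forall>x. (\<lambda>n. \<Sum>k<n. scaleC (cinner ((V1 ^^ k) f) x) ((V1 ^^ k) f)) \<longlonglongrightarrow> x)"

text \<open>\<open>adj V f = 0\<close> makes \<open>f\<close> orthogonal to the range of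
  \<open>V\<close>; common powers of \<open>V\<close> are peeled off both sides.\<close>

lemma wandering_orthonormal:
  assumes V: "isometry V" and f: "adj V f = 0" "norm f = 1"
  shows "cinner ((V ^^ j) f) ((V ^^ k) f) = (if j = k then 1 else 0)"
proof (induction j arbitrary: k)
  case 0
  have "cinner f (V y) = 0" for y
    using adj_cinner'[OF isometry_bounded_clinear[OF V], of f y] f by simp
  then show ?case using f by (cases k) (simp_all add: cinner_self_eq_norm)
next
  case (Suc j)
  have "cinner (V y) f = 0" for y
    using adj_cinner[OF isometry_bounded_clinear[OF V], of y f] f by simp
  then show ?case using Suc by (cases k) (simp_all add: isometry_cinner[OF V])
qed

section \<open>Expansions along an orthonormal sequence\<close>

lemma orthonormal_norm_sum:
  fixes e :: "nat \<Rightarrow> 'a::complex_inner"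
  assumes "\<And>j k. cinner (e j) (e k) = (if j = k then 1 else 0)" and "finite A"
  shows "(norm (\<Sum>k\<in>A. scaleC (a k) (e k)))\<^sup>2 = (\<Sum>k\<in>A. (cmod (a k))\<^sup>2)"
proof -
  have "complex_of_real ((norm (\<Sum>k\<in>A. scaleC (a k) (e k)))\<^sup>2) = (\<Sum>k\<in>A. cnj (a k) * a k)"
    using assms(2) unfolding cinner_self_eq_norm[symmetric]
    by (simp add: cinner_sum_left cinner_sum_right cinner_scaleC_left cinner_scaleC_right assms(1)
        if_distrib cong: if_cong) (simp add: mult.commute)
  also have "\<dots> = of_real (\<Sum>k\<in>A. (cmod (a k))\<^sup>2)"
    unfolding of_real_sum complex_norm_square by (simp add: mult.commute)
  finally show ?thesis using of_real_eq_iff by blast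
qed

lemma orthonormal_cinner_limit:
  fixes e :: "nat \<Rightarrow> 'a::complex_inner"
  assumes on: "\<And>j k. cinner (e j) (e k) = (if j = k then 1 else 0)"
    and lim: "(\<lambda>n. \<Sum>k<n. scaleC (a k) (e k)) \<longlonglongrightarrow> x"
  shows "cinner (e j) x = a j"
proof -
  have "(\<lambda>n. cinner (e j) (\<Sum>k<n. scaleC (a k) (e k))) \<longlonglongrightarrow> cinner (e j) x"
    by (rule tendsto_cinner[OF lim])
  moreover have "\<forall>\<^sub>F n in sequentially. cinner (e j) (\<Sum>k<n. scaleC (a k) (e k)) = a j"
    using eventually_gt_at_top[of j]
    by eventually_elim
      (simp add: cinner_sum_right cinner_scaleC_right on if_distrib cong: if_cong)
  ultimately show ?thesis
    using LIMSEQ_unique[OF _ tendsto_eventually] by blast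
qed

text \<open>The partial sum \<open>p\<close> satisfies \<open>cinner p x\<close> = squared norm of
  \<open>p\<close>, so Cauchy-Schwarz suffices.\<close>

lemma orthonormal_bessel:
  fixes e :: "nat \<Rightarrow> 'a::complex_inner"
  assumes on: "\<And>j k. cinner (e j) (e k) = (if j = k then 1 else 0)"
  shows "norm (\<Sum>k<n. scaleC (cinner (e k) x) (e k)) \<le> norm x"
proof -
  define p where "p = (\<Sum>k<n. scaleC (cinner (e k) x) (e k))"
  have "cinner p x = (\<Sum>k<n. cnj (cinner (e k) x) * cinner (e k) x)"
    by (simp add: p_def cinner_sum_left cinner_scaleC_left)
  also have "\<dots> = of_real (\<Sum>k<n. (cmod (cinner (e k) x))\<^sup>2)"
    unfolding of_real_sum complex_norm_square by (simp add: mult.commute)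
  also have "\<dots> = of_real ((norm p)\<^sup>2)"
    by (simp only: p_def orthonormal_norm_sum[OF on finite_lessThan])
  finally have "(norm p)\<^sup>2 \<le> norm p * norm x"
    using norm_cinner_le[of p x] by (simp add: norm_power)
  then show ?thesis
    unfolding p_def[symmetric] by (cases "p = 0") (simp_all add: power2_eq_square)
qed

text \<open>The partial-sum maps are contractions uniformly in \<open>n\<close>, which permits a
  three-epsilon argument.\<close>

lemma orthonormal_expansion_closed:
  fixes e :: "nat \<Rightarrow> 'a::complex_inner"
  assumes on: "\<And>j k. cinner (e j) (e k) = (if j = k then 1 else 0)"
  shows "closed {x. (\<lambda>n. \<Sum>k<n. scaleC (cinner (e k) x) (e k)) \<longlonglongrightarrow> x}" (is "closed ?M")
proof -
  define P where "P n x = (\<Sum>k<n. scaleC (cinner (e k) x) (e k))" for n x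
  have Pdiff: "P n (x - y) = P n x - P n y" for n x y
    by (simp add: P_def cinner_diff_right scaleC_diff_left sum_subtractf)
  have "x \<in> ?M" if xs: "\<And>i. xs i \<in> ?M" and lim: "xs \<longlonglongrightarrow> x" for xs x
  proof -
    have "(\<lambda>n. P n x) \<longlonglongrightarrow> x"
    proof (rule LIMSEQ_I)
      fix r :: real assume "r > 0"
      then obtain i where i: "norm (xs i - x) < r / 3"
        using LIMSEQ_D[OF lim, of "r / 3"] by auto
      have "(\<lambda>n. P n (xs i)) \<longlonglongrightarrow> xs i" using xs by (simp add: P_def)
      then obtain N where N: "\<And>n. n \<ge> N \<Longrightarrow> norm (P n (xs i) - xs i) < r / 3"
        using LIMSEQ_D[of _ "xs i" "r / 3"] \<open>r > 0\<close> by auto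
      have "norm (P n x - x) < r" if "n \<ge> N" for n
      proof -
        have "norm (P n (x - xs i)) \<le> norm (x - xs i)"
          unfolding P_def by (rule orthonormal_bessel[OF on])
        moreover have eq: "P n x - x = P n (x - xs i) + (P n (xs i) - xs i) + (xs i - x)"
          by (simp add: Pdiff)
        ultimately show ?thesis
          unfolding eq
          using N[OF that] i norm_minus_commute[of x "xs i"]
            norm_triangle_ineq[of "P n (x - xs i) + (P n (xs i) - xs i)" "xs i - x"]
            norm_triangle_ineq[of "P n (x - xs i)" "P n (xs i) - xs i"] by linarith
      qed
      then show "\<exists>N. \<forall>n\<ge>N. norm (P n x - x) < r" by blast
    qed
    then show ?thesis by (simp add: P_def)
  qed
  then show ?thesis by (simp only: closed_sequential_limits) blast
qed

section \<open>Reduction of an irreducible pair to the model\<close>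

lemma irreducible_two_finite_is_rotated_shift:
  fixes V1 V2 :: "'a::chilbert_space \<Rightarrow> 'a"
  assumes two: "two_finite_pair V1 V2" and irr: "irreducible_pair V1 V2"
    and sp: "spectrum (cross_comm V1 V2) - {0} = {\<alpha>}"
  obtains f where "rotated_shift_pair V1 V2 (cnj \<alpha>) f"
proof -
  let ?N = "cross_comm V1 V2" and ?C = "defect_op V1 V2"
  have p: "isometric_pair V1 V2" and cpt: "compact_op ?N" and nor: "normal_op ?N"
    and rk: "rank_two ?C"
    using two by (auto simp: two_finite_pair_def compact_normal_pair_def BCL_pair_def)
  have V: "isometry V1" "isometry V2" and com: "\<And>x. V1 (V2 x) = V2 (V1 x)"
    using p by (auto simp: isometric_pair_def fun_eq_iff)
  have \<alpha>: "\<alpha> \<in> spectrum ?N" "\<alpha> \<noteq> 0" using sp by auto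
  note lin = isometry_clinear[OF V(1)] isometry_clinear[OF V(2)]
    isometry_clinear_adj[OF V(1)] isometry_clinear_adj[OF V(2)]
  note lin_simps = lin[THEN clinear_scaleC] lin[THEN clinear_zero] lin[THEN clinear_add]
    lin[THEN clinear_minus] lin[THEN clinear_sum]
  note bl = isometry_bounded_linear[OF V(1)] isometry_bounded_linear[OF V(2)]
    isometry_bounded_linear_adj[OF V(1)] isometry_bounded_linear_adj[OF V(2)]
  from compact_normal_eigenvector[OF cpt nor \<alpha>]
  obtain f where f: "norm f = 1" "?N f = scaleC \<alpha> f" "adj ?N f = scaleC (cnj \<alpha>) f" by blast
  have b: "bounded_clinear ?N" using nor by (simp add: normal_op_def)
  note w = cross_eigenvector_in_wandering[OF p b \<alpha>(2) f(2,3)]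
  have V21: "adj V2 (V1 f) = scaleC \<alpha> f"
    using f(2) by (simp add: cross_comm_def w lin_simps)
  have V12: "adj V1 (V2 f) = scaleC (cnj \<alpha>) f"
    using f(3) unfolding adj_cross_comm[OF p b] by (simp add: cross_comm_def w lin_simps)
  have "?C f = f" by (simp add: defect_op_def w lin_simps)
  \<comment> \<open>In the defect of \<open>V1 f\<close> the first two terms cancel and the last
    vanishes because \<open>adj V1 f = 0\<close>; only \<open>-\<alpha>\<close> times
    \<open>V2 f\<close> remains. The next claim is symmetric.\<close>
  moreover have "?C (scaleC (- 1 / \<alpha>) (V1 f)) = V2 f" using \<alpha>(2)
    by (simp add: defect_op_def lin_simps V21 w isometry_adj_self V scaleC_scaleC
        scaleC_minus_left[of 1] scaleC_one)
  moreover have "?C (scaleC (- 1 / cnj \<alpha>) (V2 f)) = V1 f" using \<alpha>(2)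
    by (simp add: defect_op_def lin_simps V12 w isometry_adj_self V scaleC_scaleC
        scaleC_minus_left[of 1] scaleC_one)
  ultimately have "f \<in> range ?C" "V1 f \<in> range ?C" "V2 f \<in> range ?C"
    by (metis rangeI)+
  moreover have "cinner f (V1 f) = 0" "cinner f (V2 f) = 0"
    using w by (simp_all flip: adj_cinner'[OF isometry_bounded_clinear[OF V(1)]]
        adj_cinner'[OF isometry_bounded_clinear[OF V(2)]])
  moreover have "f \<noteq> 0" "V1 f \<noteq> 0" using f(1) isometry_norm[OF V(1), of f] by auto
  ultimately obtain t where t: "V2 f = scaleC t (V1 f)"
    using rank_two_orthogonal_dependent[OF rk] by metis
  have "scaleC t f = scaleC (cnj \<alpha>) f"
    using V12 by (simp add: t lin_simps isometry_adj_self V)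
  then have "scaleC (t - cnj \<alpha>) f = 0" by (simp add: scaleC_diff_left)
  then have "t = cnj \<alpha>" using norm_scaleC[of "t - cnj \<alpha>" f] f(1) by simp
  then have V2f: "V2 f = scaleC (cnj \<alpha>) (V1 f)" using t by simp
  \<comment> \<open>Both isometries preserve the norm of \<open>f\<close>, while \<open>V2 f\<close>
    is \<open>cnj \<alpha>\<close> times \<open>V1 f\<close>.\<close>
  have unit: "cmod \<alpha> = 1"
    using isometry_norm[OF V(2), of f] f(1) by (simp add: V2f norm_scaleC isometry_norm V)
  define e where "e k = (V1 ^^ k) f" for k
  have e0: "e 0 = f" and eS: "\<And>k. V1 (e k) = e (Suc k)" by (simp_all add: e_def)
  have on: "cinner (e j) (e k) = (if j = k then 1 else 0)" for j k
    unfolding e_def by (rule wandering_orthonormal[OF V(1) w(1) f(1)])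
  have V2e: "V2 (e k) = scaleC (cnj \<alpha>) (V1 (e k))" for k
  proof (induction k)
    case (Suc k)
    then show ?case by (metis eS com lin(1) clinear_scaleC)
  qed (simp add: e0 V2f)
  have aV1e: "adj V1 (e k) = (if k = 0 then 0 else e (k - 1))" for k
    by (cases k) (simp_all add: e0 w isometry_adj_self[OF V(1)] flip: eS)
  have aV2e: "adj V2 (e k) = scaleC \<alpha> (adj V1 (e k))" for k
  proof (cases k)
    case 0 then show ?thesis by (simp add: e0 w)
  next
    case (Suc j)
    \<comment> \<open>\<open>cmod \<alpha> = 1\<close> lets \<open>\<alpha>\<close> undo the factor
      \<open>cnj \<alpha>\<close> in \<open>V2e\<close>.\<close>
    have "e k = scaleC \<alpha> (V2 (e j))"
      using complex_norm_square[of \<alpha>] unit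
      by (simp add: V2e scaleC_scaleC Suc eS scaleC_one)
    then have "adj V2 (e k) = scaleC \<alpha> (e j)"
      by (simp add: lin_simps isometry_adj_self V)
    then show ?thesis by (simp add: aV1e Suc)
  qed
  define P where "P n x = (\<Sum>k<n. scaleC (cinner (e k) x) (e k))" for n x
  \<comment> \<open>The reducing subspace is taken as the set of vectors equal to their expansion,
    so \<open>M = UNIV\<close> is directly the expansion clause of the model.\<close>
  define M where "M = {x. (\<lambda>n. P n x) \<longlonglongrightarrow> x}"
  have sub: "csubspace M"
    unfolding csubspace_def
  proof (intro conjI ballI allI)
    show "0 \<in> M" by (simp add: M_def P_def)
    show "x + y \<in> M" if "x \<in> M" "y \<in> M" for x y
      using tendsto_add[of "\<lambda>n. P n x" x _ "\<lambda>n. P n y" y] that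
      by (simp add: M_def P_def cinner_add_right scaleC_add_left sum.distrib)
    show "scaleC c x \<in> M" if "x \<in> M" for c x
      using tendsto_scaleC[of "\<lambda>n. P n x" x sequentially c] that
      by (simp add: M_def P_def cinner_scaleC_right scaleC_sum_right scaleC_scaleC)
  qed
  have clo: "closed M"
    unfolding M_def P_def by (rule orthonormal_expansion_closed[OF on])
  have "V1 x \<in> M" if "x \<in> M" for x
  proof -
    \<comment> \<open>The new zeroth coefficient \<open>cinner f (V1 x)\<close> vanishes, and the
      others shift by one.\<close>
    have "P (Suc n) (V1 x) = V1 (P n x)" for n
      using w unfolding P_def sum.lessThan_Suc_shift
      by (simp add: lin_simps e0 isometry_adj_self[OF V(1)] adj_cinner'[OF isometry_bounded_clinear[OF V(1)], symmetric]
          flip: eS)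
    then have "(\<lambda>n. P (Suc n) (V1 x)) \<longlonglongrightarrow> V1 x"
      using that bounded_linear.tendsto[OF bl(1)] by (simp add: M_def)
    then show ?thesis by (simp add: M_def LIMSEQ_imp_Suc)
  qed
  moreover have "adj V1 x \<in> M" if "x \<in> M" for x
  proof -
    \<comment> \<open>\<open>adj V1\<close> kills \<open>e 0\<close> and lowers every other index,
      hence the extra term on the right.\<close>
    have "P n (adj V1 x) = adj V1 (P (Suc n) x)" for n
      unfolding P_def sum.lessThan_Suc_shift
      by (simp add: lin_simps aV1e e0 adj_cinner[OF isometry_bounded_clinear[OF V(1)], symmetric] eS w)
    moreover have "(\<lambda>n. P (Suc n) x) \<longlonglongrightarrow> x"
      using that LIMSEQ_Suc[of "\<lambda>n. P n x" x] by (simp add: M_def)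
    ultimately show ?thesis
      using bounded_linear.tendsto[OF bl(3)] by (simp add: M_def)
  qed
  \<comment> \<open>The relation on each \<open>e k\<close> passes to \<open>M\<close> by linearity
    and continuity; once \<open>M = UNIV\<close> it holds everywhere.\<close>
  moreover have V2M: "V2 x = scaleC (cnj \<alpha>) (V1 x)" if "x \<in> M" for x
  proof -
    have lim: "(\<lambda>n. P n x) \<longlonglongrightarrow> x" using that by (simp add: M_def)
    have "V2 (P n x) = scaleC (cnj \<alpha>) (V1 (P n x))" for n
      by (simp add: P_def lin_simps V2e scaleC_sum_right scaleC_scaleC mult.commute)
    then show ?thesis
      using bounded_linear.tendsto[OF bl(2) lim]
        tendsto_scaleC[OF bounded_linear.tendsto[OF bl(1) lim], of "cnj \<alpha>"]
      by (simp add: LIMSEQ_unique)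
  qed
  moreover have "adj V2 x = scaleC \<alpha> (adj V1 x)" if "x \<in> M" for x
  proof -
    have lim: "(\<lambda>n. P n x) \<longlonglongrightarrow> x" using that by (simp add: M_def)
    have "adj V2 (P n x) = scaleC \<alpha> (adj V1 (P n x))" for n
      by (simp add: P_def lin_simps aV2e scaleC_sum_right scaleC_scaleC mult.commute)
    then show ?thesis
      using bounded_linear.tendsto[OF bl(4) lim]
        tendsto_scaleC[OF bounded_linear.tendsto[OF bl(3) lim], of \<alpha>]
      by (simp add: LIMSEQ_unique)
  qed
  moreover have "scaleC c x \<in> M" if "x \<in> M" for c x
    using sub that by (simp add: csubspace_def)
  ultimately have "V1 ` M \<subseteq> M" "V2 ` M \<subseteq> M" "adj V1 ` M \<subseteq> M" "adj V2 ` M \<subseteq> M"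
    by auto
  then have "M = {0} \<or> M = UNIV"
    using irr sub clo by (simp add: irreducible_pair_def)
  moreover have "f \<in> M"
  proof -
    have "P (Suc n) f = f" for n
      using w unfolding P_def sum.lessThan_Suc_shift
      by (simp add: e0 on[of 0 0, unfolded e0] on[of _ 0, unfolded e0] scaleC_one)
    then have "(\<lambda>n. P (Suc n) f) \<longlonglongrightarrow> f" by simp
    then show ?thesis by (simp add: M_def LIMSEQ_imp_Suc)
  qed
  ultimately have "M = UNIV" using \<open>f \<noteq> 0\<close> by blast
  then have "rotated_shift_pair V1 V2 (cnj \<alpha>) f"
    using V2M V w f(1) by (auto simp: rotated_shift_pair_def M_def P_def e_def)
  then show ?thesis by (rule that)
qed

text \<open>The two families are images of the same coefficients, so partial sums in either space
  have equal norms; the second series converges because the first does.\<close>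

lemma rotated_shift_transfer:
  fixes V1 V2 :: "'a::chilbert_space \<Rightarrow> 'a" and W1 W2 :: "'b::chilbert_space \<Rightarrow> 'b"
  assumes v: "rotated_shift_pair V1 V2 \<gamma> f" and w: "rotated_shift_pair W1 W2 \<delta> g"
  shows "\<exists>y. (\<lambda>n. \<Sum>k<n. scaleC (cinner ((V1 ^^ k) f) x) ((W1 ^^ k) g)) \<longlonglongrightarrow> y \<and> norm y = norm x"
proof -
  let ?c = "\<lambda>k. cinner ((V1 ^^ k) f) x"
  let ?S = "\<lambda>n. \<Sum>k<n. scaleC (?c k) ((V1 ^^ k) f)"
  let ?T = "\<lambda>n. \<Sum>k<n. scaleC (?c k) ((W1 ^^ k) g)"
  have onV: "\<And>j k. cinner ((V1 ^^ j) f) ((V1 ^^ k) f) = (if j = k then 1 else 0)"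
    and onW: "\<And>j k. cinner ((W1 ^^ j) g) ((W1 ^^ k) g) = (if j = k then 1 else 0)"
    using v w by (simp_all add: rotated_shift_pair_def wandering_orthonormal)
  have S: "?S \<longlonglongrightarrow> x" using v by (simp add: rotated_shift_pair_def)
  have "(norm (\<Sum>k\<in>A. scaleC (?c k) ((W1 ^^ k) g)))\<^sup>2
      = (norm (\<Sum>k\<in>A. scaleC (?c k) ((V1 ^^ k) f)))\<^sup>2" if "finite A" for A
    using orthonormal_norm_sum[OF onV that, of ?c] orthonormal_norm_sum[OF onW that, of ?c] by simp
  then have n: "norm (\<Sum>k\<in>A. scaleC (?c k) ((W1 ^^ k) g))
      = norm (\<Sum>k\<in>A. scaleC (?c k) ((V1 ^^ k) f))" if "finite A" for A
    using that by simp
  \<comment> \<open>A difference of partial sums is a block over \<open>{i..<j}\<close>, whose norm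
    depends only on the coefficients.\<close>
  have d: "dist (?T i) (?T j) = dist (?S i) (?S j)" for i j
  proof (induction i j rule: linorder_wlog)
    case (le i j)
    have "?T j - ?T i = (\<Sum>k\<in>{i..<j}. scaleC (?c k) ((W1 ^^ k) g))"
      "?S j - ?S i = (\<Sum>k\<in>{i..<j}. scaleC (?c k) ((V1 ^^ k) f))"
      using le sum_diff_nat_ivl[of 0 i j] by (simp_all add: lessThan_atLeast0)
    then have "dist (?T j) (?T i) = dist (?S j) (?S i)"
      using n[of "{i..<j}"] by (simp add: dist_norm)
    then show ?case
      unfolding dist_commute[of "?T i" "?T j"] dist_commute[of "?S i" "?S j"] .
  qed (simp add: dist_commute)
  have "Cauchy ?S" using S LIMSEQ_imp_Cauchy by blast
  then have "Cauchy ?T" unfolding Cauchy_def d .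
  then obtain y where y: "?T \<longlonglongrightarrow> y" using Cauchy_convergent convergentD by blast
  have "norm y = norm x"
    using LIMSEQ_unique tendsto_norm[OF y] tendsto_norm[OF S] n by (simp add: LIMSEQ_unique)
  then show ?thesis using y by blast
qed

text \<open>\<open>U\<close> carries the coefficients along \<open>(V1 ^^ k) f\<close> to
  \<open>(W1 ^^ k) g\<close>, and \<open>U'\<close> carries them back. Intertwining of the first
  isometries is an index shift; the common \<open>\<gamma>\<close> then handles the second.\<close>

lemma rotated_shift_pairs_equivalent:
  assumes v: "rotated_shift_pair V1 V2 \<gamma> f" and w: "rotated_shift_pair W1 W2 \<gamma> g"
  shows "unitarily_equivalent_pairs V1 V2 W1 W2"
proof -
  have V: "isometry V1" "adj V1 f = 0" "norm f = 1" and V2: "\<And>x. V2 x = scaleC \<gamma> (V1 x)"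
    and Vx: "\<And>x. (\<lambda>n. \<Sum>k<n. scaleC (cinner ((V1 ^^ k) f) x) ((V1 ^^ k) f)) \<longlonglongrightarrow> x"
    using v by (auto simp: rotated_shift_pair_def)
  have W: "isometry W1" "adj W1 g = 0" "norm g = 1" and W2: "\<And>x. W2 x = scaleC \<gamma> (W1 x)"
    and Wx: "\<And>x. (\<lambda>n. \<Sum>k<n. scaleC (cinner ((W1 ^^ k) g) x) ((W1 ^^ k) g)) \<longlonglongrightarrow> x"
    using w by (auto simp: rotated_shift_pair_def)
  obtain U where U: "\<And>x. (\<lambda>n. \<Sum>k<n. scaleC (cinner ((V1 ^^ k) f) x) ((W1 ^^ k) g)) \<longlonglongrightarrow> U x"
    and nU: "\<And>x. norm (U x) = norm x"
    using rotated_shift_transfer[OF v w] by metis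
  obtain U' where U': "\<And>y. (\<lambda>n. \<Sum>k<n. scaleC (cinner ((W1 ^^ k) g) y) ((V1 ^^ k) f)) \<longlonglongrightarrow> U' y"
    using rotated_shift_transfer[OF w v] by metis
  have linU: "clinear U"
    unfolding clinear_def
  proof (intro conjI allI)
    show "U (x + y) = U x + U y" for x y
      using LIMSEQ_unique[OF U[of "x + y"]] tendsto_add[OF U[of x] U[of y]]
      by (simp add: cinner_add_right scaleC_add_left sum.distrib)
    show "U (scaleC c x) = scaleC c (U x)" for c x
      using LIMSEQ_unique[OF U[of "scaleC c x"]] tendsto_scaleC[OF U[of x], of c]
      by (simp add: cinner_scaleC_right scaleC_sum_right scaleC_scaleC)
  qed
  \<comment> \<open>\<open>U\<close> preserves coefficients, so the series defining
    \<open>U' (U x)\<close> is the expansion of \<open>x\<close>.\<close>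
  have "cinner ((W1 ^^ k) g) (U x) = cinner ((V1 ^^ k) f) x" for k x
    by (rule orthonormal_cinner_limit[OF wandering_orthonormal[OF W] U])
  then have "U' (U x) = x" for x
    using LIMSEQ_unique[OF U'[of "U x"]] Vx[of x] by simp
  moreover have "cinner ((V1 ^^ k) f) (U' y) = cinner ((W1 ^^ k) g) y" for k y
    by (rule orthonormal_cinner_limit[OF wandering_orthonormal[OF V] U'])
  then have "U (U' y) = y" for y
    using LIMSEQ_unique[OF U[of "U' y"]] Wx[of y] by simp
  ultimately have "bij U" by (metis bijI')
  then have "unitary U" using linU nU by (simp add: unitary_def)
  moreover have UV: "U (V1 x) = W1 (U x)" for x
  proof -
    have "(\<Sum>k<Suc n. scaleC (cinner ((V1 ^^ k) f) (V1 x)) ((W1 ^^ k) g))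
        = W1 (\<Sum>k<n. scaleC (cinner ((V1 ^^ k) f) x) ((W1 ^^ k) g))" for n
      using V(2) unfolding sum.lessThan_Suc_shift
      by (simp add: clinear_sum clinear_scaleC isometry_clinear W(1) isometry_adj_self[OF V(1)]
          adj_cinner'[OF isometry_bounded_clinear[OF V(1)], symmetric])
    then show ?thesis
      using LIMSEQ_unique[OF LIMSEQ_Suc[OF U[of "V1 x"]]]
        bounded_linear.tendsto[OF isometry_bounded_linear[OF W(1)] U[of x]] by simp
  qed
  moreover have "U (V2 x) = W2 (U x)" for x
    by (simp add: V2 W2 UV clinear_scaleC[OF linU])
  ultimately show ?thesis
    unfolding unitarily_equivalent_pairs_def by (auto simp: fun_eq_iff intro!: exI[of _ U])
qed

text \<open>Intertwining at \<open>f\<close> makes \<open>\<gamma>\<close> and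
  \<open>\<delta>\<close> multiples of the same unit vector \<open>W1 (U f)\<close> agree.\<close>

lemma rotated_shift_pairs_equivalent_imp_eq:
  assumes v: "rotated_shift_pair V1 V2 \<gamma> f" and w: "rotated_shift_pair W1 W2 \<delta> g"
    and eq: "unitarily_equivalent_pairs V1 V2 W1 W2"
  shows "\<gamma> = \<delta>"
proof -
  obtain U where U: "clinear U" "\<And>x. norm (U x) = norm x" "\<And>x. U (V1 x) = W1 (U x)"
      "\<And>x. U (V2 x) = W2 (U x)"
    using eq by (auto simp: unitarily_equivalent_pairs_def unitary_def fun_eq_iff)
  have "scaleC (\<gamma> - \<delta>) (W1 (U f)) = 0"
    using U(4)[of f] v w
    by (simp add: rotated_shift_pair_def clinear_scaleC[OF U(1)] U(3) scaleC_diff_left)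
  moreover have "norm (W1 (U f)) = 1"
    using v w by (simp add: rotated_shift_pair_def isometry_norm U(2))
  ultimately show ?thesis using norm_scaleC[of "\<gamma> - \<delta>" "W1 (U f)"] by simp
qed

theorem theorem6p4:
  fixes V1 V2 :: "'a::chilbert_space \<Rightarrow> 'a"
    and W1 W2 :: "'b::chilbert_space \<Rightarrow> 'b"
    and \<alpha> \<beta> :: complex
  assumes "separable_space TYPE('a)" and "separable_space TYPE('b)"
    and "two_finite_pair V1 V2" and "irreducible_pair V1 V2"
    and "two_finite_pair W1 W2" and "irreducible_pair W1 W2"
    and "spectrum (cross_comm V1 V2) - {0} = {\<alpha>}"
    and "spectrum (cross_comm W1 W2) - {0} = {\<beta>}"
  shows "unitarily_equivalent_pairs V1 V2 W1 W2 \<longleftrightarrow> \<alpha> = \<beta>"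
proof -
  obtain f g where "rotated_shift_pair V1 V2 (cnj \<alpha>) f" "rotated_shift_pair W1 W2 (cnj \<beta>) g"
    using irreducible_two_finite_is_rotated_shift assms by metis
  then show ?thesis
    using rotated_shift_pairs_equivalent rotated_shift_pairs_equivalent_imp_eq
    by (metis complex_cnj_cancel_iff)
qed

end
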